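(* There is an absolute constant $C>0$ such that the following holds. For every finite set $P \subset \mathbb{R}^2$ with diameter $D$, in the minimum backlog game on $P$ the player has a strategy which guarantees that, against every adversary, no cup ever contains more than $C\cdot D$ units of water.
   Context: The minimum backlog game on a finite planar set $P\subset\mathbb{R}^2$: a cup is placed at each point of $P$, all cups initially empty. Over continuous time $t\ge 0$ an adversary pours water into the cups; at every time the total rate at which water is poured into all cups together is $1$, and the adversary may distribute it among the cups arbitrarily, possibly depending on the player's past motion. The player moves in the plane with (at most) unit speed, starting at an arbitrary point; whenever the player is at the location of a cup, that cup is emptied. The player at any time knows the current amount of water in every cup but has no information about future pouring. The backlog is the maximum amount of water in any cup at any time; the player aims to keep it small. The diameter of $P$ is $D=\max_{p,q\in P}\|p-q\|$. *)

theory Defs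
  imports "HOL-Analysis.Analysis"
begin

type_synonym plane = "real ^ 2"

text \<open>A motion gives the position of the player at each time, a pouring gives the rate at which
  each cup is filled at each time; only times \<open>t \<ge> 0\<close> and cups in \<open>P\<close> matter. A cup is
  identified with its location.\<close>

type_synonym motion = "real \<Rightarrow> plane"

type_synonym pouring = "plane \<Rightarrow> real \<Rightarrow> real"

definition unit_speed :: "motion \<Rightarrow> bool" where
  "unit_speed x \<longleftrightarrow> 1-lipschitz_on {0..} x"

definition valid_pouring :: "plane set \<Rightarrow> pouring \<Rightarrow> bool" where
  "valid_pouring P r \<longleftrightarrow>
     (\<forall>p\<in>P. \<forall>t\<ge>0. 0 \<le> r p t \<and> r p integrable_on {0..t}) \<and>
     (\<forall>t\<ge>0. (\<Sum>p\<in>P. r p t) = 1)"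

definition last_emptied :: "motion \<Rightarrow> plane \<Rightarrow> real \<Rightarrow> real" where
  "last_emptied x p t = Sup (insert 0 {s \<in> {0..t}. x s = p})"

text \<open>Unit-speed motions are continuous, so the set of visits to \<open>p\<close> during \<open>[0, t]\<close> is closed
  and the supremum above is attained. The time \<open>0\<close> is included because all cups start empty.\<close>

definition water :: "motion \<Rightarrow> pouring \<Rightarrow> plane \<Rightarrow> real \<Rightarrow> real" where
  "water x r p t = integral {last_emptied x p t..t} (r p)"

text \<open>A player strategy responds to a pouring with a motion, where the position at time \<open>t\<close> may
  depend only on the amounts of water poured up to time \<open>t\<close>; in particular the starting point is
  chosen by the player in advance. Knowing these amounts is the same as knowing the water levels up
  to time \<open>t\<close>: the player knows its own motion, stands at no more than one cup at a time, and the
  total rate is \<open>1\<close>, so what flows into the cup it is standing at is determined by the other cups.\<close>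

definition player_strategy :: "plane set \<Rightarrow> (pouring \<Rightarrow> motion) \<Rightarrow> bool" where
  "player_strategy P \<sigma> \<longleftrightarrow>
     (\<forall>r. valid_pouring P r \<longrightarrow> unit_speed (\<sigma> r)) \<and>
     (\<forall>r r'. \<forall>t\<ge>0. valid_pouring P r \<longrightarrow> valid_pouring P r' \<longrightarrow>
        (\<forall>p\<in>P. \<forall>s\<in>{0..t}. integral {0..s} (r p) = integral {0..s} (r' p)) \<longrightarrow>
        \<sigma> r t = \<sigma> r' t)"

definition adversary_strategy :: "plane set \<Rightarrow> (motion \<Rightarrow> pouring) \<Rightarrow> bool" where
  "adversary_strategy P \<alpha> \<longleftrightarrow>
     (\<forall>x. unit_speed x \<longrightarrow> valid_pouring P (\<alpha> x)) \<and>
     (\<forall>x y. \<forall>t\<ge>0. unit_speed x \<longrightarrow> unit_speed y \<longrightarrow>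
        (\<forall>s\<in>{0..t}. x s = y s) \<longrightarrow> (\<forall>p\<in>P. \<alpha> x p t = \<alpha> y p t))"

definition play ::
  "plane set \<Rightarrow> (pouring \<Rightarrow> motion) \<Rightarrow> (motion \<Rightarrow> pouring) \<Rightarrow> motion \<Rightarrow> pouring \<Rightarrow> bool" where
  "play P \<sigma> \<alpha> x r \<longleftrightarrow> unit_speed x \<and> valid_pouring P r \<and>
     (\<forall>t\<ge>0. x t = \<sigma> r t) \<and> (\<forall>p\<in>P. \<forall>t\<ge>0. r p t = \<alpha> x p t)"

text \<open>In continuous time two strategies reacting to each other instantaneously need not admit any
  play. The existence clause below excludes player strategies for which the game would not be
  well-defined against some adversary. Constant adversary strategies are included, so every valid
  pouring occurs in some play.\<close>

definition guarantees_backlog :: "plane set \<Rightarrow> (pouring \<Rightarrow> motion) \<Rightarrow> real \<Rightarrow> bool" where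
  "guarantees_backlog P \<sigma> B \<longleftrightarrow>
     (\<forall>\<alpha>. adversary_strategy P \<alpha> \<longrightarrow>
        (\<exists>x r. play P \<sigma> \<alpha> x r) \<and>
        (\<forall>x r. play P \<sigma> \<alpha> x r \<longrightarrow> (\<forall>p\<in>P. \<forall>t\<ge>0. water x r p t \<le> B)))"

end

theory Submission
  imports Defs
begin

text \<open>Let \<open>D\<close> be the diameter. Time is cut into slots of length \<open>4 D\<close>; in each slot the player walks a
  closed loop from a fixed home cup. Up to \<open>m\<^sup>3\<close> cups can be visited by \<open>O(m\<^sup>2)\<close> such loops, because a
  grid of \<open>O(m\<^sup>2)\<close> cells of side \<open>D / m\<close> splits them into \<open>O(m\<^sup>2)\<close> groups of at most \<open>m\<close> cups, and a group
  is walked in time \<open>m \<cdot> O(D / m)\<close>. Slot \<open>n\<close> serves the level \<open>i\<close> given by the 2-adic valuation of \<open>n\<close>, so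
  that level \<open>i\<close> owns a fraction \<open>2\<^sup>-\<^sup>i\<^sup>-\<^sup>1\<close> of all slots. During each window of \<open>512 \<cdot> 32\<^sup>i\<close> slots the level
  visits the \<open>63 \<cdot> 64\<^sup>i\<close> cups that are fullest at the start of the window.

  Let \<open>a\<^sub>i\<close> be the largest possible total of \<open>64\<^sup>i\<close> cups, divided by \<open>64\<^sup>i\<close>. Removing the \<open>63 \<cdot> 64\<^sup>i\<close> fullest
  among \<open>64\<^sup>i\<^sup>+\<^sup>1\<close> cups does not increase the average, and at most two windows' worth of water is poured
  since, so \<open>a\<^sub>i \<le> a\<^sub>i\<^sub>+\<^sub>1 + O(D \<cdot> 32\<^sup>i / 64\<^sup>i)\<close>. The increments form a geometric series, whose sum bounds
  \<open>a\<^sub>0\<close> by \<open>O(D)\<close>, independently of the number of cups.\<close>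

section \<open>Loops through groups of nearby cups\<close>

lemma ex_top_subset:
  fixes w :: "'a \<Rightarrow> real"
  assumes "finite P" "k \<le> card P"
  shows "\<exists>S\<subseteq>P. card S = k \<and> (\<forall>p\<in>S. \<forall>q\<in>P - S. w q \<le> w p)"
  using assms(2)
proof (induction k)
  case 0
  then show ?case by (intro exI[of _ "{}"]) auto
next
  case (Suc k)
  then obtain S where S: "S \<subseteq> P" "card S = k" "\<forall>p\<in>S. \<forall>q\<in>P - S. w q \<le> w p"
    by auto
  have fin: "finite S" "finite (P - S)"
    using S(1) assms(1) finite_subset by auto
  have "P - S \<noteq> {}"
    using S Suc.prems fin by (metis Diff_eq_empty_iff card_mono not_less_eq_eq)
  then obtain p where p: "p \<in> P - S" "\<forall>q\<in>P - S. w q \<le> w p"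
    using obtains_MAX[OF fin(2), of w] Max_ge[of "w ` (P - S)"] fin
    by (metis finite_imageI imageI)
  show ?case
    using S p fin by (intro exI[of _ "insert p S"]) auto
qed

text \<open>As long as some cell holds \<open>m\<close> points, split off \<open>m\<close> of them as a group; then every cell is a
  group.\<close>

lemma ex_small_groups:
  fixes c :: "'a \<Rightarrow> 'b"
  assumes "finite S" "c ` S \<subseteq> K" "finite K" "0 < m"
  shows "\<exists>F. finite F \<and> \<Union>F = S \<and> (\<forall>G\<in>F. card G \<le> m \<and> (\<forall>p\<in>G. \<forall>q\<in>G. c p = c q)) \<and>
    m * card F \<le> card S + m * card K"
  using assms(1,2)
proof (induction S rule: finite_psubset_induct)
  case (psubset S)
  show ?case
  proof (cases "\<exists>k\<in>K. m \<le> card {p\<in>S. c p = k}")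
    case True
    then obtain k G where G: "G \<subseteq> {p\<in>S. c p = k}" "card G = m"
      by (metis obtain_subset_with_card_n)
    have fG: "finite G" and "G \<noteq> {}"
      using G assms(4) card.infinite by fastforce+
    then have "S - G \<subset> S"
      using G by auto
    moreover have "c ` (S - G) \<subseteq> K"
      using psubset.prems by auto
    ultimately obtain F where
      F: "finite F" "\<Union>F = S - G" "\<forall>G\<in>F. card G \<le> m \<and> (\<forall>p\<in>G. \<forall>q\<in>G. c p = c q)"
        "m * card F \<le> card (S - G) + m * card K"
      using psubset.IH by metis
    \<comment> \<open>Each group split off uses up \<open>m\<close> points, which pays for the
      \<open>m\<close> that it adds to the left side of the count.\<close>
    have "card (S - G) + m = card S"
    proof -
      have "G \<subseteq> S"
        using G by auto
      then show ?thesis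
        using G fG psubset.hyps card_Diff_subset[of G S] card_mono[of S G] by auto
    qed
    moreover have "m * card (insert G F) \<le> m * card F + m"
      using F(1) by (simp add: card_insert_if)
    ultimately have "m * card (insert G F) \<le> card S + m * card K"
      using F(4) by linarith
    moreover have "\<Union> (insert G F) = S"
      using F(2) G(1) by blast
    moreover have "card G \<le> m" "\<forall>p\<in>G. \<forall>q\<in>G. c p = c q"
      using G by auto
    ultimately show ?thesis
      using F(1,3) by (intro exI[of _ "insert G F"]) blast
  next
    case False
    let ?F = "(\<lambda>k. {p\<in>S. c p = k}) ` K"
    have "card ?F \<le> card K"
      by (rule card_image_le[OF assms(3)])
    then have "m * card ?F \<le> card S + m * card K"
      by (metis mult_le_mono2 trans_le_add2)
    then show ?thesis
      using False psubset.prems assms(3) by (intro exI[of _ ?F]) auto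
  qed
qed

section \<open>Unit-speed walks through finitely many points\<close>

lemma lipschitz_on_append:
  fixes f g :: "real \<Rightarrow> 'a::metric_space"
  assumes f: "1-lipschitz_on {0..a} f" and g: "1-lipschitz_on {0..b} g" and "f a = g 0"
    and "0 \<le> a" "0 \<le> b"
  shows "1-lipschitz_on {0..a + b} (\<lambda>s. if s \<le> a then f s else g (s - a))"
proof (rule lipschitz_on_concat[OF f])
  show "1-lipschitz_on {a..a + b} (\<lambda>s. g (s - a))"
  proof (rule lipschitz_onI)
    fix s t assume "s \<in> {a..a + b}" "t \<in> {a..a + b}"
    then show "dist (g (s - a)) (g (t - a)) \<le> 1 * dist s t"
      using lipschitz_onD[OF g, of "s - a" "t - a"] by (auto simp: dist_real_def)
  qed simp
qed (use assms in auto)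

lemma ex_lipschitz_segment:
  fixes a b :: "'a::real_normed_vector"
  assumes "dist a b \<le> L"
  shows "\<exists>\<gamma>. 1-lipschitz_on {0..L} \<gamma> \<and> \<gamma> 0 = a \<and> \<gamma> L = b"
proof -
  have L: "0 \<le> L"
    using assms zero_le_dist[of a b] by linarith
  let ?g = "\<lambda>s. a + (s / L) *\<^sub>R (b - a)"
  have "dist (?g s) (?g t) \<le> 1 * dist s t" for s t
  proof -
    have "dist (?g s) (?g t) = norm (((s - t) / L) *\<^sub>R (b - a))"
      by (simp add: dist_norm scaleR_left_diff_distrib diff_divide_distrib)
    also have "\<dots> = \<bar>s - t\<bar> * (dist a b / L)"
      using L by (simp add: dist_norm norm_minus_commute)
    also have "\<dots> \<le> \<bar>s - t\<bar> * 1"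
      using L assms by (intro mult_left_mono) (auto simp: divide_le_eq_1)
    finally show ?thesis by (simp add: dist_real_def)
  qed
  then have "1-lipschitz_on {0..L} ?g"
    by (auto simp: lipschitz_on_def)
  moreover have "?g L = b"
    using assms by (cases "L = 0") auto
  ultimately show ?thesis
    by (intro exI[of _ ?g]) auto
qed

text \<open>Every leg is allotted the same time \<open>d\<close> and the way to \<open>h\<close> the
  time \<open>e\<close>; shorter legs are walked more slowly. So the duration depends only on the
  number of points.\<close>

lemma ex_lipschitz_walk:
  fixes a h :: "'a::real_normed_vector"
  assumes "\<And>p q. p \<in> set (a # ps) \<Longrightarrow> q \<in> set (a # ps) \<Longrightarrow> dist p q \<le> d"
    and "\<And>p. p \<in> set (a # ps) \<Longrightarrow> dist p h \<le> e"
  shows "\<exists>\<gamma>. 1-lipschitz_on {0..d * length ps + e} \<gamma> \<and> \<gamma> 0 = a \<and>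
    \<gamma> (d * length ps + e) = h \<and> set (a # ps) \<subseteq> \<gamma> ` {0..d * length ps + e}"
  using assms
proof (induction ps arbitrary: a)
  case Nil
  then have "dist a h \<le> e" by simp
  moreover from this have "0 \<le> e"
    using zero_le_dist[of a h] by linarith
  moreover obtain \<gamma> where "1-lipschitz_on {0..e} \<gamma>" "\<gamma> 0 = a" "\<gamma> e = h"
    using ex_lipschitz_segment[OF \<open>dist a h \<le> e\<close>] by blast
  ultimately show ?case
    by (intro exI[of _ \<gamma>]) auto
next
  case (Cons p ps)
  let ?L = "d * length ps + e"
  have d: "dist a p \<le> d" "0 \<le> d" "0 \<le> e"
    using Cons.prems(1)[of a p] Cons.prems(2)[of a] order_trans[OF zero_le_dist[of a p]]
      order_trans[OF zero_le_dist[of a h]]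
    by auto
  have L: "0 \<le> ?L"
    using d by simp
  have "\<exists>\<gamma>. 1-lipschitz_on {0..?L} \<gamma> \<and> \<gamma> 0 = p \<and> \<gamma> ?L = h \<and> set (p # ps) \<subseteq> \<gamma> ` {0..?L}"
    by (rule Cons.IH) (use Cons.prems in auto)
  then obtain \<gamma> where g: "1-lipschitz_on {0..?L} \<gamma>" "\<gamma> 0 = p" "\<gamma> ?L = h"
    "set (p # ps) \<subseteq> \<gamma> ` {0..?L}"
    by blast
  obtain \<beta> where b: "1-lipschitz_on {0..d} \<beta>" "\<beta> 0 = a" "\<beta> d = p"
    using ex_lipschitz_segment[OF d(1)] by blast
  define \<eta> where "\<eta> = (\<lambda>s. if s \<le> d then \<beta> s else \<gamma> (s - d))"
  have shift: "\<eta> (d + s) = \<gamma> s" if "0 \<le> s" for s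
    using that b g by (auto simp: \<eta>_def)
  have len: "d * real (length (p # ps)) + e = d + ?L"
    by (simp add: algebra_simps)
  have "1-lipschitz_on {0..d + ?L} \<eta>"
    unfolding \<eta>_def using b g L d by (intro lipschitz_on_append) auto
  moreover have "\<eta> 0 = a"
    using d b by (simp add: \<eta>_def)
  moreover have "\<eta> (d + ?L) = h"
    using shift[OF L] g by simp
  moreover have "set (p # ps) \<subseteq> \<eta> ` {0..d + ?L}"
  proof
    fix q assume "q \<in> set (p # ps)"
    then obtain s where "s \<in> {0..?L}" "q = \<gamma> s"
      using g(4) by blast
    then show "q \<in> \<eta> ` {0..d + ?L}"
      using shift[of s] d by (intro image_eqI[of _ _ "d + s"]) auto
  qed
  moreover have "a \<in> \<eta> ` {0..d + ?L}"
    using \<open>\<eta> 0 = a\<close> d L by (intro image_eqI[of _ _ 0]) auto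
  ultimately show ?case
    unfolding len by (intro exI[of _ \<eta>]) auto
qed

text \<open>Loops start and end at the same home, so any sequence of them can be run one after the
  other without a jump.\<close>

definition is_loop :: "plane \<Rightarrow> real \<Rightarrow> motion \<Rightarrow> bool" where
  "is_loop h T \<gamma> \<longleftrightarrow> 1-lipschitz_on {0..T} \<gamma> \<and> \<gamma> 0 = h \<and> \<gamma> T = h"

text \<open>Time \<open>D\<close> suffices to reach the group, fewer than \<open>m\<close> legs of
  length at most \<open>2 * D / m\<close> take at most \<open>2 * D\<close>, and \<open>D\<close>
  suffices to return.\<close>

lemma ex_loop_through_group:
  assumes "finite G" "card G \<le> m" "0 \<le> D"
    and close: "\<And>p q. p \<in> G \<Longrightarrow> q \<in> G \<Longrightarrow> real m * dist p q \<le> 2 * D"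
    and near: "\<And>p. p \<in> G \<Longrightarrow> dist p h \<le> D"
  shows "\<exists>\<gamma>. is_loop h (4 * D) \<gamma> \<and> G \<subseteq> \<gamma> ` {0..4 * D}"
proof -
  obtain ps where ps: "set ps = G" "distinct ps"
    using finite_distinct_list[OF assms(1)] by blast
  show ?thesis
  proof (cases ps)
    case Nil
    then show ?thesis
      using ps by (intro exI[of _ "\<lambda>_. h"]) (auto simp: is_loop_def lipschitz_on_def)
  next
    case (Cons a qs)
    have len: "length (a # qs) \<le> m"
      using assms(2) ps Cons by (metis distinct_card)
    define d where "d = 2 * D / m"
    have d0: "0 \<le> d"
      using assms(3) by (simp add: d_def)
    have "d * length qs \<le> d * m"
      using len d0 by (intro mult_left_mono) auto
    also have "\<dots> = 2 * D"
      using len by (auto simp: d_def)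
    finally have le: "d * length qs \<le> 2 * D" .
    \<comment> \<open>All time left over, at least \<open>D\<close>, goes into the way home, so that
      every loop lasts exactly \<open>4 * D\<close>.\<close>
    define e where "e = 3 * D - d * length qs"
    have tot: "d * length qs + e = 3 * D"
      by (simp add: e_def)
    have "\<exists>\<gamma>. 1-lipschitz_on {0..d * length qs + e} \<gamma> \<and> \<gamma> 0 = a \<and>
      \<gamma> (d * length qs + e) = h \<and> set (a # qs) \<subseteq> \<gamma> ` {0..d * length qs + e}"
    proof (rule ex_lipschitz_walk)
      fix p q assume "p \<in> set (a # qs)" "q \<in> set (a # qs)"
      then show "dist p q \<le> d"
        using close[of p q] ps Cons len by (auto simp: d_def field_simps)
    next
      fix p assume "p \<in> set (a # qs)"
      then show "dist p h \<le> e"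
        using near[of p] ps Cons le by (auto simp: e_def)
    qed
    then obtain \<gamma> where g: "1-lipschitz_on {0..3 * D} \<gamma>" "\<gamma> 0 = a" "\<gamma> (3 * D) = h"
      "G \<subseteq> \<gamma> ` {0..3 * D}"
      unfolding tot using ps Cons by auto
    have "dist h a \<le> D"
      using near[of a] ps Cons by (auto simp: dist_commute)
    then obtain \<beta> where b: "1-lipschitz_on {0..D} \<beta>" "\<beta> 0 = h" "\<beta> D = a"
      using ex_lipschitz_segment by blast
    define \<eta> where "\<eta> = (\<lambda>s. if s \<le> D then \<beta> s else \<gamma> (s - D))"
    have shift: "\<eta> (D + s) = \<gamma> s" if "0 \<le> s" for s
      using that b g by (auto simp: \<eta>_def)
    have "1-lipschitz_on {0..D + 3 * D} \<eta>"
      unfolding \<eta>_def using b g assms(3) by (intro lipschitz_on_append) auto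
    moreover have "\<eta> 0 = h"
      using assms(3) b by (simp add: \<eta>_def)
    moreover have "\<eta> (D + 3 * D) = h"
      using shift[of "3 * D"] g assms(3) by simp
    moreover have "G \<subseteq> \<eta> ` {0..D + 3 * D}"
    proof
      fix q assume "q \<in> G"
      then obtain s where "s \<in> {0..3 * D}" "q = \<gamma> s"
        using g(4) by blast
      then show "q \<in> \<eta> ` {0..D + 3 * D}"
        using shift[of s] assms(3) by (intro image_eqI[of _ _ "D + s"]) auto
    qed
    ultimately show ?thesis
      by (intro exI[of _ \<eta>]) (simp add: is_loop_def)
  qed
qed

text \<open>At most \<open>9 * m\<^sup>2\<close> cells and \<open>m ^ 3 / m\<close> split-off groups
  give at most \<open>10 * m\<^sup>2\<close> loops. The bound is rounded up to
  \<open>16 * m\<^sup>2\<close>, a power of 2 whenever \<open>m\<close> is one, to fit the schedule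
  of slots.\<close>

lemma ex_loops:
  assumes P: "finite P" "h \<in> P" "0 < diameter P" and S: "S \<subseteq> P" "card S \<le> m ^ 3" "0 < m"
  shows "\<exists>g. (\<forall>q. is_loop h (4 * diameter P) (g q)) \<and>
    S \<subseteq> (\<Union>q<16 * m\<^sup>2. g q ` {0..4 * diameter P})"
proof -
  define D where "D = diameter P"
  have D: "0 < D"
    using P(3) by (simp add: D_def)
  have dist: "dist p q \<le> D" if "p \<in> P" "q \<in> P" for p q
    using diameter_bounded_bound[OF finite_imp_bounded[OF P(1)] that] by (simp add: D_def)
  \<comment> \<open>Coordinates relative to home, in units of the cell side \<open>D / m\<close>;
    the cell \<open>c p\<close> is found by rounding down.\<close>
  define u where "u = (\<lambda>p i. real m * (p $ i - h $ i) / D)"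
  define c :: "plane \<Rightarrow> int \<times> int" where "c = (\<lambda>p. (\<lfloor>u p 1\<rfloor>, \<lfloor>u p 2\<rfloor>))"
  define K where "K = {- int m..int m} \<times> {- int m..int m}"
  have u: "\<bar>u p i\<bar> \<le> real m" if "p \<in> P" for p i
  proof -
    have "\<bar>p $ i - h $ i\<bar> \<le> D"
      using dist_vec_nth_le[of p i h] dist[OF that P(2)] by (simp add: dist_real_def)
    then have "real m * \<bar>p $ i - h $ i\<bar> \<le> real m * D"
      by (intro mult_left_mono) auto
    then show ?thesis
      using D by (simp add: u_def abs_mult pos_divide_le_eq)
  qed
  have fl: "\<lfloor>u p i\<rfloor> \<in> {- int m..int m}" if "p \<in> P" for p i
    using u[OF that, of i] by (simp add: le_floor_iff floor_le_iff abs_le_iff)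
  have cK: "c ` S \<subseteq> K"
    using S(1) fl by (auto simp: c_def K_def)
  have finS: "finite S"
    using S(1) P(1) finite_subset by blast
  obtain F where F: "finite F" "\<Union>F = S"
    "\<forall>G\<in>F. card G \<le> m \<and> (\<forall>p\<in>G. \<forall>q\<in>G. c p = c q)"
    "m * card F \<le> card S + m * card K"
    using ex_small_groups[OF finS cK _ S(3)] unfolding K_def by (metis finite_SigmaI finite_atLeastAtMost_int)
  have "card K = (2 * m + 1)\<^sup>2"
    by (simp add: K_def card_cartesian_product power2_eq_square nat_add_distrib nat_mult_distrib)
  also have "\<dots> \<le> (3 * m)\<^sup>2"
    using S(3) by (intro power_mono) auto
  finally have "card K \<le> 9 * m\<^sup>2"
    by (simp add: power_mult_distrib)
  then have "m * card K \<le> m * (9 * m\<^sup>2)"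
    by (rule mult_le_mono2)
  then have "m * card F \<le> m ^ 3 + m * (9 * m\<^sup>2)"
    using F(4) S(2) by linarith
  also have "\<dots> = m * (10 * m\<^sup>2)"
    by (simp add: power2_eq_square power3_eq_cube)
  finally have cardF: "card F \<le> 10 * m\<^sup>2"
    using S(3) by simp
  have loop: "\<exists>\<gamma>. is_loop h (4 * D) \<gamma> \<and> G \<subseteq> \<gamma> ` {0..4 * D}" if G: "G \<in> F" for G
  proof (rule ex_loop_through_group)
    have GS: "G \<subseteq> S"
      using F(2) G by auto
    show "finite G"
      using GS finS finite_subset by blast
    show "card G \<le> m" "0 \<le> D"
      using F(3) G D by (blast, simp)
    show "dist p h \<le> D" if "p \<in> G" for p
      using dist[of p h] that GS S(1) P(2) by auto
    fix p q assume pq: "p \<in> G" "q \<in> G"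
    then have "c p = c q"
      using F(3) G by blast
    then have eq: "\<lfloor>u p 1\<rfloor> = \<lfloor>u q 1\<rfloor>" "\<lfloor>u p 2\<rfloor> = \<lfloor>u q 2\<rfloor>"
      by (simp_all add: c_def)
    have 1: "\<bar>u p i - u q i\<bar> \<le> 1" if "\<lfloor>u p i\<rfloor> = \<lfloor>u q i\<rfloor>" for i
      using that by linarith
    have 2: "real m * \<bar>p $ i - q $ i\<bar> \<le> D" if "\<lfloor>u p i\<rfloor> = \<lfloor>u q i\<rfloor>" for i
    proof -
      have "u p i - u q i = real m * (p $ i - q $ i) / D"
        by (simp add: u_def diff_divide_distrib[symmetric] algebra_simps)
      then have "real m * \<bar>p $ i - q $ i\<bar> / D \<le> 1"
        using 1[OF that] D by (simp add: abs_mult)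
      then show ?thesis
        using D by (simp add: pos_divide_le_eq)
    qed
    have "real m * dist p q \<le> real m * (\<bar>p $ 1 - q $ 1\<bar> + \<bar>p $ 2 - q $ 2\<bar>)"
      using norm_le_l1_cart[of "p - q"]
      by (intro mult_left_mono) (auto simp: dist_norm sum_2)
    then show "real m * dist p q \<le> 2 * D"
      using 2[OF eq(1)] 2[OF eq(2)] by (simp add: algebra_simps)
  qed
  then obtain \<Gamma> where \<Gamma>: "\<And>G. G \<in> F \<Longrightarrow> is_loop h (4 * D) (\<Gamma> G) \<and> G \<subseteq> \<Gamma> G ` {0..4 * D}"
    by metis
  obtain e where e: "bij_betw e {0..<card F} F"
    using ex_bij_betw_nat_finite[OF F(1)] by blast
  \<comment> \<open>The surplus indices are filled with standing still at home.\<close>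
  define g where "g = (\<lambda>q. if q < card F then \<Gamma> (e q) else (\<lambda>_. h))"
  have "is_loop h (4 * D) (g q)" for q
    using \<Gamma> e bij_betwE[OF e] by (auto simp: g_def is_loop_def lipschitz_on_def)
  moreover have "p \<in> (\<Union>q<16 * m\<^sup>2. g q ` {0..4 * D})" if "p \<in> S" for p
  proof -
    obtain G where G: "G \<in> F" "p \<in> G"
      using F(2) \<open>p \<in> S\<close> by blast
    obtain q where q: "q < card F" "e q = G"
      using e G(1) by (metis atLeastLessThan_iff bij_betw_iff_bijections)
    have "p \<in> g q ` {0..4 * D}"
      using \<Gamma>[OF G(1)] G q by (auto simp: g_def)
    moreover have "q < 16 * m\<^sup>2"
      using q cardF by linarith
    ultimately show ?thesis by blast
  qed
  ultimately show ?thesis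
    unfolding D_def by blast
qed

section \<open>The schedule of slots and the discrete game\<close>

text \<open>One slot in \<open>2 ^ Suc i\<close> has level \<open>i\<close>, so this length provides
  a slot for each of the \<open>256 * 16 ^ i\<close> loops of a sweep.\<close>

definition window :: "nat \<Rightarrow> nat" where
  "window i = 512 * 32 ^ i"

definition level :: "nat \<Rightarrow> nat" where
  "level m = multiplicity 2 m"

definition window_start :: "nat \<Rightarrow> nat" where
  "window_start m = m - m mod window (level m)"

text \<open>Slots of level \<open>i\<close> sit at odd multiples of \<open>2 ^ i\<close>; this
  numbers them consecutively from 0 within their window.\<close>

definition part :: "nat \<Rightarrow> nat" where
  "part m = (m mod window (level m)) div 2 ^ Suc (level m)"

lemma window_eq: "window i = 2 ^ Suc i * (256 * 16 ^ i)"
proof -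
  have "(2::nat) ^ i * 16 ^ i = 32 ^ i"
    by (simp flip: power_mult_distrib)
  then show ?thesis
    by (simp add: window_def)
qed

text \<open>Since \<open>2 ^ Suc i\<close> divides \<open>window i\<close>, the number
  \<open>m\<close> is \<open>2 ^ i\<close> times an odd number. This locates the slot in which loop
  \<open>q\<close> of a given window is run.\<close>

lemma schedule:
  assumes "q < 256 * 16 ^ i" and m: "m = n * window i + (q * 2 ^ Suc i + 2 ^ i)"
  shows "level m = i" "window_start m = n * window i" "part m = q" "m \<in> {n * window i..<Suc n * window i}"
proof -
  let ?r = "q * 2 ^ Suc i + 2 ^ i"
  have lt: "(2::nat) ^ i < 2 ^ Suc i"
    by simp
  have "?r < Suc q * 2 ^ Suc i"
    using lt by simp
  also have "\<dots> \<le> 256 * 16 ^ i * 2 ^ Suc i"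
    using assms(1) by (intro mult_le_mono1) simp
  also have "\<dots> = window i"
    by (simp add: window_eq mult.commute)
  finally have r: "?r < window i" .
  define k where "k = n * (256 * 16 ^ i) + q"
  have odd: "m = 2 ^ i * (2 * k + 1)"
    by (simp add: m k_def window_eq algebra_simps)
  have "\<not> 2 ^ Suc i dvd m"
    by (simp add: odd power_Suc2 del: power_Suc mult_Suc_right)
  then show lev: "level m = i"
    unfolding level_def by (intro multiplicity_eqI) (auto simp: odd)
  have mod: "m mod window i = ?r"
    using r by (simp add: m)
  show "window_start m = n * window i"
    unfolding window_start_def lev mod by (simp add: m)
  have "?r div 2 ^ Suc i = q"
    using lt by (simp only: div_mult_self3 div_less)
  then show "part m = q"
    unfolding part_def lev mod .
  show "m \<in> {n * window i..<Suc n * window i}"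
    using r by (simp add: m)
qed

text \<open>Removing the largest values cannot raise the average \<open>A\<close>: the least value
  on \<open>S\<close> bounds the average over \<open>S\<close> from below and every value on
  \<open>J\<close> from above. If \<open>J\<close> has fewer than \<open>j\<close> elements, the
  missing ones count as 0.\<close>

lemma sum_le_of_top:
  fixes w :: "'a \<Rightarrow> real"
  assumes "finite J" "finite S" "J \<inter> S = {}"
    and "\<And>p. p \<in> J \<union> S \<Longrightarrow> 0 \<le> w p"
    and top: "\<And>p q. p \<in> S \<Longrightarrow> q \<in> J \<Longrightarrow> w q \<le> w p"
    and "card J \<le> j" "sum w (J \<union> S) \<le> real (j + card S) * A" "S \<noteq> {}"
  shows "sum w J \<le> real j * A"
proof -
  obtain p where p: "p \<in> S" "\<And>q. q \<in> S \<Longrightarrow> w p \<le> w q"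
    using ex_min_if_finite[of "w ` S"] assms(2,8) by (metis (no_types, lifting) arg_min_if_finite(1) arg_min_least)
  have "sum w J \<le> real (card J) * w p"
    using sum_bounded_above[of J w "w p"] top p(1) by simp
  also have "\<dots> \<le> real j * w p"
    using assms(4,6) p(1) by (intro mult_right_mono) auto
  finally have J: "sum w J \<le> real j * w p" .
  have "real (card S) * sum w J \<le> real j * (real (card S) * w p)"
    using mult_left_mono[OF J, of "card S"] by (simp add: mult_ac)
  also have "\<dots> \<le> real j * sum w S"
    using sum_bounded_below[of S "w p" w] p(2) by (intro mult_left_mono) auto
  finally have "real (j + card S) * sum w J \<le> real j * (sum w J + sum w S)"
    by (simp add: algebra_simps)
  also have "\<dots> = real j * sum w (J \<union> S)"
    using assms(1-3) by (simp add: sum.union_disjoint)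
  also have "\<dots> \<le> real j * (real (j + card S) * A)"
    using assms(7) by (intro mult_left_mono) auto
  finally have "real (j + card S) * sum w J \<le> real (j + card S) * (real j * A)"
    by (simp add: mult_ac)
  moreover have "0 < card S"
    using assms(2,8) by (simp add: card_gt_0_iff)
  ultimately show ?thesis
    by (simp del: of_nat_add)
qed

section \<open>Sweeps, tours and bounds on the levels\<close>

locale cup_game =
  fixes P :: "plane set" and h :: plane
  assumes finite_P: "finite P" and home: "h \<in> P" and diameter_pos: "0 < diameter P"
begin

definition T :: real where
  "T = 4 * diameter P"

lemma T_pos: "0 < T"
  using diameter_pos by (simp add: T_def)

text \<open>The size \<open>63 * 64 ^ i\<close> is chosen so that the swept cups and
  \<open>64 ^ i\<close> further ones make up \<open>64 ^ Suc i\<close>; with fewer cups around, all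
  are swept. Indices beyond the last loop also give loops, so that every tour is one.\<close>

definition is_sweep :: "nat \<Rightarrow> (plane \<Rightarrow> real) \<Rightarrow> (nat \<Rightarrow> motion) \<Rightarrow> bool" where
  "is_sweep i w g \<longleftrightarrow> (\<forall>q. is_loop h T (g q)) \<and>
    (\<exists>S\<subseteq>P. S \<subseteq> (\<Union>q<256 * 16 ^ i. g q ` {0..T}) \<and>
      (S = P \<or> card S = 63 * 64 ^ i \<and> (\<forall>p\<in>S. \<forall>q\<in>P - S. w q \<le> w p)))"

text \<open>Take \<open>m = 4 ^ Suc i\<close> in \<open>ex_loops\<close>: then
  \<open>m ^ 3 = 64 ^ Suc i\<close> and \<open>16 * m\<^sup>2 = 256 * 16 ^ i\<close>.\<close>

lemma ex_sweep: "\<exists>g. is_sweep i w g"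
proof -
  have "\<exists>S\<subseteq>P. card S \<le> 63 * 64 ^ i \<and>
      (S = P \<or> card S = 63 * 64 ^ i \<and> (\<forall>p\<in>S. \<forall>q\<in>P - S. w q \<le> w p))"
  proof (cases "card P \<le> 63 * 64 ^ i")
    case False
    then have "63 * 64 ^ i \<le> card P"
      by simp
    from ex_top_subset[OF finite_P this, of w] show ?thesis
      by (metis order_refl)
  qed blast
  then obtain S where S: "S \<subseteq> P" "card S \<le> 63 * 64 ^ i"
    "S = P \<or> card S = 63 * 64 ^ i \<and> (\<forall>p\<in>S. \<forall>q\<in>P - S. w q \<le> w p)"
    by blast
  have "((4::nat) ^ Suc i) ^ 3 = (4 ^ 3) ^ Suc i"
    by (simp only: power_mult[symmetric] mult.commute)
  then have "card S \<le> (4 ^ Suc i) ^ 3"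
    using S(2) by simp
  from ex_loops[OF finite_P home diameter_pos S(1) this zero_less_power]
  obtain g where g: "\<forall>q. is_loop h T (g q)" "S \<subseteq> (\<Union>q<16 * ((4::nat) ^ Suc i)\<^sup>2. g q ` {0..T})"
    unfolding T_def by (metis zero_less_numeral)
  have "((4::nat) ^ Suc i)\<^sup>2 = (4\<^sup>2) ^ Suc i"
    by (simp only: power_mult[symmetric] mult.commute)
  then have "16 * ((4::nat) ^ Suc i)\<^sup>2 = 256 * 16 ^ i"
    by simp
  with g S have "is_sweep i w g"
    unfolding is_sweep_def by metis
  then show ?thesis
    by blast
qed

text \<open>The choice is a function of \<open>i\<close> and \<open>w\<close> alone: equal knowledge
  leads to equal motions.\<close>

definition sweep :: "nat \<Rightarrow> (plane \<Rightarrow> real) \<Rightarrow> nat \<Rightarrow> motion" where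
  "sweep i w = (SOME g. is_sweep i w g)"

lemma is_sweep_sweep: "is_sweep i w (sweep i w)"
  unfolding sweep_def by (rule someI_ex[OF ex_sweep])

text \<open>Upper bounds for the water levels at the start of slot \<open>m\<close>, where \<open>I m p\<close> is the amount poured into
  \<open>p\<close> during slot \<open>m\<close>: a cup visited in a slot counts as emptied at the beginning of that slot. The
  player plans with these bounds instead of the actual levels.\<close>

function levels :: "(nat \<Rightarrow> plane \<Rightarrow> real) \<Rightarrow> nat \<Rightarrow> plane \<Rightarrow> real" where
  "levels I 0 = (\<lambda>p. 0)"
| "levels I (Suc m) = (\<lambda>p. I m p +
    (if p \<in> sweep (level m) (levels I (window_start m)) (part m) ` {0..T} then 0 else levels I m p))"
  by pat_completeness auto
termination
  by (relation "Wellfounded.measure snd") (auto simp: window_start_def less_Suc_eq_le)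

definition tour :: "(nat \<Rightarrow> plane \<Rightarrow> real) \<Rightarrow> nat \<Rightarrow> motion" where
  "tour I m = sweep (level m) (levels I (window_start m)) (part m)"

lemma is_loop_tour: "is_loop h T (tour I m)"
  using is_sweep_sweep unfolding tour_def is_sweep_def by blast

lemma levels_Suc: "levels I (Suc m) p = I m p + (if p \<in> tour I m ` {0..T} then 0 else levels I m p)"
  by (simp add: tour_def)

declare levels.simps(2) [simp del]

lemma levels_cong:
  assumes "\<And>l p. l < m \<Longrightarrow> I l p = I' l p"
  shows "levels I m = levels I' m"
  using assms
proof (induction m rule: less_induct)
  case (less m)
  show ?case
  proof (cases m)
    case (Suc n)
    have "levels I n = levels I' n"
      using Suc less.prems by (intro less.IH) auto
    moreover have "levels I (window_start n) = levels I' (window_start n)"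
      using Suc less.prems by (intro less.IH) (auto simp: window_start_def)
    moreover have "I n p = I' n p" for p
      using Suc less.prems by simp
    ultimately show ?thesis
      by (simp add: Suc levels.simps(2) cong: if_cong)
  qed simp
qed

text \<open>The plan for a slot is fixed before the slot begins, which gives the strategy its
  delay.\<close>

lemma tour_cong:
  assumes "\<And>l p. l < m \<Longrightarrow> I l p = I' l p"
  shows "tour I m = tour I' m"
proof -
  have "levels I (window_start m) = levels I' (window_start m)"
    using assms by (intro levels_cong) (auto simp: window_start_def)
  then show ?thesis
    by (simp add: tour_def)
qed

text \<open>All slots of level \<open>i\<close> in one window plan with the levels at its start
  \<open>s\<close>, so together they run through one complete sweep.\<close>

lemma tours_visit_top:
  assumes "s = n * window i"
  shows "\<exists>S\<subseteq>P. (\<forall>p\<in>S. \<exists>a\<in>{s..<s + window i}. p \<in> tour I a ` {0..T}) \<and>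
    (S = P \<or> card S = 63 * 64 ^ i \<and> (\<forall>p\<in>S. \<forall>q\<in>P - S. levels I s q \<le> levels I s p))"
proof -
  obtain S where S: "S \<subseteq> P" "S \<subseteq> (\<Union>q<256 * 16 ^ i. sweep i (levels I s) q ` {0..T})"
    "S = P \<or> card S = 63 * 64 ^ i \<and> (\<forall>p\<in>S. \<forall>q\<in>P - S. levels I s q \<le> levels I s p)"
    using is_sweep_sweep[of i "levels I s"] unfolding is_sweep_def by blast
  have "\<exists>a\<in>{s..<s + window i}. p \<in> tour I a ` {0..T}" if "p \<in> S" for p
  proof -
    obtain q where q: "q < 256 * 16 ^ i" "p \<in> sweep i (levels I s) q ` {0..T}"
      using S(2) \<open>p \<in> S\<close> by blast
    define a where "a = n * window i + (q * 2 ^ Suc i + 2 ^ i)"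
    note sch = schedule[OF q(1) a_def]
    have "tour I a = sweep i (levels I s) q"
      by (simp only: tour_def sch assms)
    moreover have "a \<in> {s..<s + window i}"
      using sch(4) by (simp add: assms add.commute)
    ultimately show ?thesis
      using q(2) by metis
  qed
  then show ?thesis
    using S by blast
qed

text \<open>Water present at \<open>s\<close> survives only in cups not visited since; a visit may
  leave water poured later, which the sum covers.\<close>

lemma levels_le:
  assumes "s \<le> m" and nonneg: "\<And>l. 0 \<le> I l p"
  shows "levels I m p \<le> (\<Sum>l=s..<m. I l p) +
    (if \<exists>a\<in>{s..<m}. p \<in> tour I a ` {0..T} then 0 else levels I s p)"
  using assms(1)
proof (induction m rule: dec_induct)
  case (step m)
  have "0 \<le> (\<Sum>l=s..<m. I l p)"
    using nonneg by (simp add: sum_nonneg)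
  moreover have "{s..<Suc m} = insert m {s..<m}"
    using step.hyps by auto
  ultimately show ?case
    using step by (auto simp: levels_Suc split: if_splits)
qed simp

lemma levels_nonneg:
  assumes "\<And>l. 0 \<le> I l p"
  shows "0 \<le> levels I m p"
  using assms by (induction m) (auto simp: levels_Suc)

text \<open>The bound \<open>b i\<close> on the right solves
  \<open>b i = b (Suc i) / 64 + 2 * window i * c\<close>, each summand being half of it. The
  induction runs downwards in \<open>i\<close>; once \<open>63 * 64 ^ i\<close> exceeds the number
  of cups, a sweep visits all of them.\<close>

lemma sum_levels_le:
  assumes nonneg: "\<And>l p. p \<in> P \<Longrightarrow> 0 \<le> I l p" and total: "\<And>l. (\<Sum>p\<in>P. I l p) = c"
    and "J \<subseteq> P" "card J \<le> 64 ^ i"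
  shows "(\<Sum>p\<in>J. levels I m p) \<le> 2048 * c * 32 ^ i"
  using assms(3,4)
proof (induction "card P - i" arbitrary: i m J rule: less_induct)
  case less
  have finJ: "finite J"
    using less.prems(1) finite_P finite_subset by blast
  have c: "0 \<le> c"
    using sum_nonneg[of P "I 0"] nonneg total by auto
  have sum_J: "(\<Sum>p\<in>J. I l p) \<le> c" for l
    unfolding total[of l, symmetric] using less.prems(1) nonneg finite_P by (intro sum_mono2) auto
  have poured: "(\<Sum>p\<in>J. levels I m p) \<le> (\<Sum>p\<in>J - S. levels I s p) + real (m - s) * c"
    if "s \<le> m" "\<And>p. p \<in> S \<Longrightarrow> \<exists>a\<in>{s..<m}. p \<in> tour I a ` {0..T}" for s S
  proof -
    have "(\<Sum>p\<in>J. levels I m p) \<le>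
        (\<Sum>p\<in>J. (\<Sum>l=s..<m. I l p) + (if p \<in> S then 0 else levels I s p))"
    proof (rule sum_mono)
      fix p assume "p \<in> J"
      then have p: "\<And>l. 0 \<le> I l p"
        using nonneg less.prems(1) by auto
      show "levels I m p \<le> (\<Sum>l=s..<m. I l p) + (if p \<in> S then 0 else levels I s p)"
        using levels_le[OF that(1), of I, OF p] that(2)[of p] levels_nonneg[of I p s, OF p]
        by (auto split: if_splits)
    qed
    also have "\<dots> = (\<Sum>l=s..<m. \<Sum>p\<in>J. I l p) + (\<Sum>p\<in>J - S. levels I s p)"
      using finJ sum.swap[of "\<lambda>p l. I l p" "{s..<m}" J]
      by (simp add: sum.distrib sum.If_cases Diff_eq)
    also have "\<dots> \<le> (\<Sum>l=s..<m. c) + (\<Sum>p\<in>J - S. levels I s p)"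
      using sum_J by (intro add_right_mono sum_mono)
    finally show ?thesis by simp
  qed
  have pow: "0 \<le> c * 32 ^ i"
    using c by simp
  show ?case
  proof (cases "m < window i")
    \<comment> \<open>No window is complete yet, but the total poured so far is small.\<close>
    case True
    then have "real m * c \<le> real (window i) * c"
      using c by (intro mult_right_mono) auto
    then have "real m * c \<le> 512 * (c * 32 ^ i)"
      by (simp add: window_def mult_ac)
    then show ?thesis
      using poured[of 0 "{}"] pow by simp
  next
    case False
    \<comment> \<open>The last window completed by time \<open>m\<close>. The current one may be
      unfinished, so up to two windows of pouring come after its start \<open>s\<close>.\<close>
    define n where "n = m div window i - 1"
    define s where "s = n * window i"
    have "1 \<le> m div window i"
      using False by (simp add: window_def Suc_le_eq div_greater_zero_iff)
    then have "s + window i = m div window i * window i"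
      unfolding s_def n_def by (metis add.commute le_add_diff_inverse2 mult_Suc plus_1_eq_Suc)
    moreover have "m div window i * window i \<le> m" "m < m div window i * window i + window i"
      using mod_less_divisor[of "window i" m] div_mult_mod_eq[of m "window i"]
      by (auto simp: window_def simp del: mod_less_divisor)
    ultimately have s: "s + window i \<le> m" "m - s \<le> 2 * window i"
      by linarith+
    have "real (m - s) * c \<le> real (2 * window i) * c"
      using c s(2) by (intro mult_right_mono) (auto simp only: of_nat_le_iff)
    then have extra: "real (m - s) * c \<le> 1024 * (c * 32 ^ i)"
      by (simp add: window_def mult_ac)
    obtain S where S: "S \<subseteq> P" "\<forall>p\<in>S. \<exists>a\<in>{s..<s + window i}. p \<in> tour I a ` {0..T}"
      "S = P \<or> card S = 63 * 64 ^ i \<and> (\<forall>p\<in>S. \<forall>q\<in>P - S. levels I s q \<le> levels I s p)"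
      using tours_visit_top[OF s_def, of I] by (elim exE conjE)
    have "{s..<s + window i} \<subseteq> {s..<m}"
      using s(1) by auto
    then have "\<exists>a\<in>{s..<m}. p \<in> tour I a ` {0..T}" if "p \<in> S" for p
      using S(2) that by (meson subset_iff)
    then have le: "(\<Sum>p\<in>J. levels I m p) \<le> (\<Sum>p\<in>J - S. levels I s p) + 1024 * (c * 32 ^ i)"
      using poured[of s S, OF add_leD1[OF s(1)]] extra by fastforce
    have "(\<Sum>p\<in>J - S. levels I s p) \<le> 1024 * (c * 32 ^ i)"
    proof (cases "S = P")
      case True
      then show ?thesis
        using less.prems(1) pow by (simp add: Diff_eq_empty_iff[THEN iffD2])
    next
      case False
      then have top: "card S = 63 * 64 ^ i" "\<And>p q. p \<in> S \<Longrightarrow> q \<in> P - S \<Longrightarrow> levels I s q \<le> levels I s p"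
        using S(3) by auto
      have finS: "finite S"
        using S(1) finite_P finite_subset by blast
      \<comment> \<open>A sweep that leaves out a cup forces \<open>i\<close> below
        \<open>card P\<close>, so the induction measure drops.\<close>
      have "i < 64 ^ i"
        by (rule power_gt_expt) simp
      then have "i < card P"
        using card_mono[OF finite_P S(1)] top(1) by linarith
      then have dec: "card P - Suc i < card P - i"
        by simp
      have "card (J - S) \<le> 64 ^ i"
        using less.prems(2) card_mono[OF finJ, of "J - S"] by auto
      moreover have "card ((J - S) \<union> S) \<le> card (J - S) + card S"
        by (rule card_Un_le)
      ultimately have "card ((J - S) \<union> S) \<le> 64 ^ Suc i"
        using top(1) by simp
      then have "(\<Sum>p\<in>(J - S) \<union> S. levels I s p) \<le> 2048 * c * 32 ^ Suc i"
        using less.prems(1) S(1) by (intro less.hyps[OF dec]) auto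
      \<comment> \<open>Written as number of cups times average:
        \<open>64 ^ i + card S = 64 ^ Suc i\<close>, and
        \<open>2048 * 32 / 64 = 1024\<close>.\<close>
      also have "\<dots> = real (64 ^ i + card S) * (1024 * (c * (32 ^ i / 64 ^ i)))"
        by (simp add: top(1) field_simps)
      finally have "(\<Sum>p\<in>J - S. levels I s p) \<le> real (64 ^ i) * (1024 * (c * (32 ^ i / 64 ^ i)))"
      proof (rule sum_le_of_top[rotated -2])
        show "S \<noteq> {}"
          using top(1) by auto
        show "0 \<le> levels I s p" if "p \<in> J - S \<union> S" for p
          using that less.prems(1) S(1) nonneg by (intro levels_nonneg) auto
        show "levels I s q \<le> levels I s p" if "p \<in> S" "q \<in> J - S" for p q
          using that top(2) less.prems(1) by auto
      qed (use finJ finS \<open>card (J - S) \<le> 64 ^ i\<close> in auto)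
      then show ?thesis
        by simp
    qed
    then show ?thesis
      using le by (simp add: mult_ac)
  qed
qed

end

section \<open>Existence of plays\<close>

text \<open>Turns agreement of motions up to \<open>a\<close> into the agreement of poured amounts
  on which the player's reply depends.\<close>

lemma adversary_integrals_eq:
  assumes "adversary_strategy P \<alpha>" "unit_speed x" "unit_speed y"
    and "\<And>t. t \<in> {0..a} \<Longrightarrow> x t = y t" "p \<in> P" "s \<in> {0..a}"
  shows "integral {0..s} (\<alpha> x p) = integral {0..s} (\<alpha> y p)"
proof (rule integral_cong)
  fix t assume "t \<in> {0..s}"
  then have "0 \<le> t" "\<forall>u\<in>{0..t}. x u = y u"
    using assms(4,6) by auto
  then show "\<alpha> x p t = \<alpha> y p t"
    using assms(1-3,5) unfolding adversary_strategy_def by blast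
qed

text \<open>The strategy reacts with a delay of up to one slot, so iterating the exchange of responses fixes
  one further slot in each round.\<close>

lemma ex_play:
  assumes "0 < T"
    and speed: "\<And>r. unit_speed (\<sigma> r)"
    and delayed: "\<And>r r' m t. valid_pouring P r \<Longrightarrow> valid_pouring P r' \<Longrightarrow>
      (\<And>p s. p \<in> P \<Longrightarrow> s \<in> {0..real m * T} \<Longrightarrow> integral {0..s} (r p) = integral {0..s} (r' p)) \<Longrightarrow>
      t \<in> {0..real (Suc m) * T} \<Longrightarrow> \<sigma> r t = \<sigma> r' t"
    and \<alpha>: "adversary_strategy P \<alpha>"
  shows "\<exists>x r. play P \<sigma> \<alpha> x r"
proof -
  have valid: "valid_pouring P (\<alpha> x)" if "unit_speed x" for x
    using \<alpha> that unfolding adversary_strategy_def by blast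
  have "unit_speed (\<lambda>_. 0)"
    by (simp add: unit_speed_def lipschitz_on_def)
  note valid0 = valid[OF this]
  \<comment> \<open>Start from any motion and alternate the adversary's reply with the
    player's.\<close>
  define x where "x = rec_nat (\<sigma> (\<alpha> (\<lambda>_. 0))) (\<lambda>_ y. \<sigma> (\<alpha> y))"
  have x0: "x 0 = \<sigma> (\<alpha> (\<lambda>_. 0))" and xSuc: "x (Suc n) = \<sigma> (\<alpha> (x n))" for n
    by (simp_all add: x_def)
  have x: "unit_speed (x n)" for n
    by (cases n) (simp_all add: x0 xSuc speed)
  have step: "x (Suc n) t = x n t" if "t \<in> {0..real (Suc n) * T}" for n t
    using that
  proof (induction n arbitrary: t)
    case 0
    \<comment> \<open>In the first slot the player has no information: only the integrals over
      \<open>{0..0}\<close> are compared.\<close>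
    show ?case
      unfolding xSuc x0
      by (rule delayed[OF valid[OF speed] valid0 _ 0]) auto
  next
    case (Suc n)
    have "\<sigma> (\<alpha> (x (Suc n))) t = \<sigma> (\<alpha> (x n)) t"
      by (rule delayed[OF valid[OF x] valid[OF x] adversary_integrals_eq[OF \<alpha> x x Suc.IH] Suc.prems])
    then show ?case
      by (simp only: xSuc)
  qed
  have agree: "x k t = x n t" if "n \<le> k" "t \<in> {0..real (Suc n) * T}" for n k t
    using that(1)
  proof (induction k rule: dec_induct)
    case (step k)
    have "real (Suc n) * T \<le> real (Suc k) * T"
      using step.hyps assms(1) by (intro mult_right_mono) auto
    then show ?case
      using \<open>\<And>n t. t \<in> {0..real (Suc n) * T} \<Longrightarrow> x (Suc n) t = x n t\<close>[of t k] step.IH that(2) by auto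
  qed simp
  \<comment> \<open>By round \<open>nat \<lceil>t / T\<rceil>\<close> the position at time
    \<open>t\<close> no longer changes, so this limit motion agrees with \<open>x n\<close> on the
    first \<open>Suc n\<close> slots.\<close>
  define y where "y = (\<lambda>t. x (nat \<lceil>t / T\<rceil>) t)"
  have y: "y t = x n t" if "t \<in> {0..real (Suc n) * T}" for n t
  proof -
    define k where "k = nat \<lceil>t / T\<rceil>"
    have "t / T \<le> real k"
      unfolding k_def by (rule real_nat_ceiling_ge)
    then have "t \<le> real (Suc k) * T"
      using assms(1) by (simp add: pos_divide_le_eq algebra_simps)
    then show ?thesis
      using agree[of n k t] agree[of k n t] that unfolding y_def k_def[symmetric]
      by (cases "n \<le> k") auto
  qed
  have ex_n: "\<exists>n. t \<le> real (Suc n) * T" for t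
  proof -
    obtain n where "t / T \<le> real n"
      using real_arch_simple by blast
    then have "t \<le> real (Suc n) * T"
      using assms(1) by (simp add: pos_divide_le_eq algebra_simps)
    then show ?thesis ..
  qed
  have ys: "unit_speed y"
    unfolding unit_speed_def
  proof (rule lipschitz_onI)
    fix s t :: real assume st: "s \<in> {0..}" "t \<in> {0..}"
    obtain n where "max s t \<le> real (Suc n) * T"
      using ex_n by blast
    then have "y s = x n s" "y t = x n t"
      using st y by auto
    then show "dist (y s) (y t) \<le> 1 * dist s t"
      using x[of n] st lipschitz_onD unfolding unit_speed_def by metis
  qed simp
  have "y t = \<sigma> (\<alpha> y) t" if "0 \<le> t" for t
  proof -
    obtain n where n: "t \<le> real (Suc n) * T"
      using ex_n by blast
    then have t: "t \<in> {0..real (Suc (Suc n)) * T}" "t \<in> {0..real (Suc n) * T}"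
      using that assms(1) by (auto simp: algebra_simps)
    \<comment> \<open>As \<open>y\<close> and \<open>x n\<close> agree on \<open>Suc n\<close>
      slots, the replies to them agree for one slot more; the reply to \<open>x n\<close> is
      \<open>x (Suc n)\<close>, which is \<open>y\<close> there.\<close>
    have "\<sigma> (\<alpha> y) t = \<sigma> (\<alpha> (x n)) t"
      by (rule delayed[OF valid[OF ys] valid[OF x] adversary_integrals_eq[OF \<alpha> ys x y] t(1)])
    then show ?thesis
      using y[OF t(1)] by (simp add: xSuc)
  qed
  then have "play P \<sigma> \<alpha> y (\<alpha> y)"
    unfolding play_def using ys valid by blast
  then show ?thesis
    by blast
qed

section \<open>The strategy in continuous time\<close>

text \<open>The last emptying is no earlier than any given visit \<open>s\<close>, and rates are
  nonnegative.\<close>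

lemma water_le:
  assumes "valid_pouring P r" "p \<in> P" "s \<in> {0..t}" "s = 0 \<or> x s = p"
  shows "water x r p t \<le> integral {s..t} (r p)"
proof -
  let ?V = "insert 0 {s \<in> {0..t}. x s = p}"
  have t: "0 \<le> t"
    using assms(3) by auto
  have "s \<le> Sup ?V"
    using assms(3,4) t by (intro cSup_upper bdd_aboveI[of _ t]) auto
  moreover have "Sup ?V \<le> t"
    using t by (intro cSup_least) auto
  ultimately have sub: "{last_emptied x p t..t} \<subseteq> {s..t}" "{s..t} \<subseteq> {0..t}"
    using assms(3) by (auto simp: last_emptied_def)
  have r: "r p integrable_on {0..t}" "\<And>u. 0 \<le> u \<Longrightarrow> 0 \<le> r p u"
    using assms(1,2) t unfolding valid_pouring_def by auto
  show ?thesis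
    unfolding water_def
    using sub r assms(3) integrable_on_subinterval[OF r(1), of _ t]
    by (intro integral_subset_le integrable_on_subinterval[OF r(1)]) auto
qed

context cup_game
begin

text \<open>The value \<open>0\<close> outside \<open>P\<close> keeps the choices made in \<open>sweep\<close> independent of the pouring at points
  that are not cups.\<close>

definition poured :: "pouring \<Rightarrow> nat \<Rightarrow> plane \<Rightarrow> real" where
  "poured r m p =
    (if p \<in> P then integral {0..real (Suc m) * T} (r p) - integral {0..real m * T} (r p) else 0)"

definition motion :: "pouring \<Rightarrow> motion" where
  "motion r t = (let m = nat \<lfloor>t / T\<rfloor> in tour (poured r) m (t - real m * T))"

text \<open>At the right end of a slot \<open>motion\<close> already follows the next tour, but both
  tours are at home then.\<close>

lemma motion_eq:
  assumes "t \<in> {real m * T..real (Suc m) * T}"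
  shows "motion r t = tour (poured r) m (t - real m * T)"
proof (cases "t = real (Suc m) * T")
  case True
  have "t / T = real (Suc m)"
    using T_pos by (simp add: True)
  then have "nat \<lfloor>t / T\<rfloor> = Suc m"
    by (simp del: of_nat_Suc)
  moreover have "t - real m * T = T"
    by (simp add: True algebra_simps)
  ultimately show ?thesis
    using is_loop_tour[of "poured r" "Suc m"] is_loop_tour[of "poured r" m] True
    by (simp add: motion_def is_loop_def)
next
  case False
  then have "real m \<le> t / T" "t / T < real (Suc m)"
    using assms T_pos by (auto simp: pos_le_divide_eq pos_divide_less_eq)
  then have "\<lfloor>t / T\<rfloor> = int m"
    by (simp add: floor_eq_iff)
  then show ?thesis
    by (simp add: motion_def)
qed

lemma ex_slot:
  assumes "t \<in> {0..real (Suc m) * T}"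
  shows "\<exists>k\<le>m. t \<in> {real k * T..real (Suc k) * T}"
  using assms
proof (induction m)
  case (Suc m)
  show ?case
  proof (cases "t \<le> real (Suc m) * T")
    case True
    then show ?thesis
      using Suc by (meson atLeastAtMost_iff le_SucI)
  next
    case False
    then show ?thesis
      using Suc.prems by (intro exI[of _ "Suc m"]) auto
  qed
qed simp

lemma unit_speed_motion: "unit_speed (motion r)"
  unfolding unit_speed_def
proof (rule lipschitz_onI)
  fix s t :: real assume st: "s \<in> {0..}" "t \<in> {0..}"
  obtain m where "max s t / T \<le> real m"
    using real_arch_simple by blast
  then have m: "max s t \<le> real (Suc m) * T"
    using T_pos by (simp add: pos_divide_le_eq algebra_simps)
  have "1-lipschitz_on {0..real (Suc m) * T} (motion r)"
  proof (rule lipschitz_on_closed_Union[of "{..m}"])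
    fix k
    have "1-lipschitz_on {real k * T..real (Suc k) * T} (\<lambda>t. tour (poured r) k (t - real k * T))"
    proof (rule lipschitz_onI)
      fix u v assume "u \<in> {real k * T..real (Suc k) * T}" "v \<in> {real k * T..real (Suc k) * T}"
      then have "u - real k * T \<in> {0..T}" "v - real k * T \<in> {0..T}"
        by (auto simp: algebra_simps)
      then show "dist (tour (poured r) k (u - real k * T)) (tour (poured r) k (v - real k * T)) \<le> 1 * dist u v"
        using is_loop_tour[of "poured r" k]
          lipschitz_onD[of 1 "{0..T}" "tour (poured r) k" "u - real k * T" "v - real k * T"]
        by (simp add: is_loop_def dist_real_def)
    qed simp
    then show "1-lipschitz_on {real k * T..real (Suc k) * T} (motion r)"
      by (rule lipschitz_on_transform) (simp only: motion_eq)
  next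
    show "{0..real (Suc m) * T} \<subseteq> (\<Union>k\<in>{..m}. {real k * T..real (Suc k) * T})"
    proof
      fix u assume "u \<in> {0..real (Suc m) * T}"
      then show "u \<in> (\<Union>k\<in>{..m}. {real k * T..real (Suc k) * T})"
        using ex_slot[of u m] by blast
    qed
  qed simp_all
  then show "dist (motion r s) (motion r t) \<le> 1 * dist s t"
    using st m lipschitz_onD[of 1 "{0..real (Suc m) * T}" "motion r" s t] by (simp del: of_nat_Suc)
qed simp

text \<open>The tour in slot \<open>k\<close> uses only amounts poured in earlier slots. This is the
  delay from which \<open>ex_play\<close> obtains plays.\<close>

lemma motion_delayed:
  assumes "\<And>p s. p \<in> P \<Longrightarrow> s \<in> {0..real m * T} \<Longrightarrow> integral {0..s} (r p) = integral {0..s} (r' p)"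
    and "t \<in> {0..real (Suc m) * T}"
  shows "motion r t = motion r' t"
proof -
  obtain k where k: "k \<le> m" "t \<in> {real k * T..real (Suc k) * T}"
    using ex_slot[OF assms(2)] by blast
  have "tour (poured r) k = tour (poured r') k"
  proof (rule tour_cong)
    fix l p assume "l < k"
    then have "real (Suc l) * T \<le> real m * T" "real l * T \<le> real m * T"
      using k(1) T_pos by (auto intro!: mult_right_mono simp del: of_nat_Suc)
    then show "poured r l p = poured r' l p"
      using assms(1) T_pos by (simp add: poured_def del: of_nat_Suc)
  qed
  then show ?thesis
    by (simp add: motion_eq[OF k(2)])
qed

lemma player_strategy_motion: "player_strategy P motion"
  unfolding player_strategy_def
proof (intro conjI allI impI unit_speed_motion)
  fix r r' :: pouring and t :: real
  assume t: "0 \<le> t" and eq: "\<forall>p\<in>P. \<forall>s\<in>{0..t}. integral {0..s} (r p) = integral {0..s} (r' p)"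
  define m where "m = nat \<lfloor>t / T\<rfloor>"
  have "real m \<le> t / T" "t / T < real m + 1"
    unfolding m_def using t T_pos by auto
  then have m: "real m * T \<le> t" "t \<le> real (Suc m) * T"
    using T_pos by (auto simp: pos_le_divide_eq pos_divide_less_eq add.commute)
  show "motion r t = motion r' t"
  proof (rule motion_delayed)
    show "integral {0..s} (r p) = integral {0..s} (r' p)" if "p \<in> P" "s \<in> {0..real m * T}" for p s
      using eq that m(1) by auto
  qed (use m t in auto)
qed

section \<open>Water poured per slot and the bound on the backlog\<close>

lemma integral_pouring_combine:
  assumes "valid_pouring P r" "p \<in> P" "0 \<le> a" "a \<le> b" "b \<le> c"
  shows "integral {a..b} (r p) + integral {b..c} (r p) = integral {a..c} (r p)"
proof -
  have "r p integrable_on {0..c}"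
    using assms unfolding valid_pouring_def by auto
  then have "r p integrable_on {a..c}"
    by (rule integrable_on_subinterval) (use assms in auto)
  then show ?thesis
    using assms by (intro Henstock_Kurzweil_Integration.integral_combine) auto
qed

lemma integral_pouring_nonneg:
  assumes "valid_pouring P r" "p \<in> P" "0 \<le> a"
  shows "0 \<le> integral {a..b} (r p)"
proof (cases "a \<le> b")
  case True
  then have "r p integrable_on {0..b}" "\<And>t. 0 \<le> t \<Longrightarrow> 0 \<le> r p t"
    using assms unfolding valid_pouring_def by auto
  moreover from this have "r p integrable_on {a..b}"
    using integrable_on_subinterval[of "r p" "{0..b}" a b] assms(3) by simp
  ultimately show ?thesis
    using assms(3) by (intro integral_nonneg) auto
qed simp

lemma sum_integral_pouring:
  assumes "valid_pouring P r" "0 \<le> t"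
  shows "(\<Sum>p\<in>P. integral {0..t} (r p)) = t"
proof -
  have "(\<Sum>p\<in>P. integral {0..t} (r p)) = integral {0..t} (\<lambda>s. \<Sum>p\<in>P. r p s)"
    using assms finite_P unfolding valid_pouring_def by (intro integral_sum[symmetric]) auto
  also have "\<dots> = integral {0..t} (\<lambda>s. 1)"
    using assms unfolding valid_pouring_def by (intro integral_cong) auto
  finally show ?thesis
    using assms(2) by simp
qed

lemma slot_bounds: "0 \<le> real m * T" "real m * T \<le> real (Suc m) * T"
  using T_pos by (auto simp: algebra_simps)

lemma poured_eq:
  assumes "valid_pouring P r" "p \<in> P"
  shows "poured r m p = integral {real m * T..real (Suc m) * T} (r p)"
  using integral_pouring_combine[OF assms order_refl slot_bounds[of m]] assms(2)
  by (simp add: poured_def del: of_nat_Suc)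

lemma sum_poured:
  assumes "valid_pouring P r"
  shows "(\<Sum>p\<in>P. poured r m p) = T"
proof -
  have "(\<Sum>p\<in>P. poured r m p) = real (Suc m) * T - real m * T"
    using sum_integral_pouring[OF assms slot_bounds(1)]
    by (simp only: poured_def sum_subtractf if_True cong: sum.cong)
  then show ?thesis
    by (simp add: algebra_simps)
qed

text \<open>Links the planned levels to the real game: a visit at \<open>s\<close> within a slot
  leaves at most what is poured after \<open>s\<close>, while \<open>levels\<close> charges the
  pouring of the whole slot.\<close>

lemma water_accounting:
  assumes r: "valid_pouring P r" and x: "\<And>t. 0 \<le> t \<Longrightarrow> x t = motion r t" and p: "p \<in> P"
  shows "\<exists>s\<in>{0..real m * T}. (s = 0 \<or> x s = p) \<and>
    integral {s..real m * T} (r p) \<le> levels (poured r) m p"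
proof (induction m)
  case (Suc m)
  let ?a = "real m * T" and ?b = "real (Suc m) * T"
  show ?case
  proof (cases "p \<in> tour (poured r) m ` {0..T}")
    case True
    then obtain u where u: "u \<in> {0..T}" "p = tour (poured r) m u"
      by blast
    define s where "s = ?a + u"
    have s: "s \<in> {?a..?b}"
      using u(1) by (auto simp: s_def algebra_simps)
    then have s0: "s \<in> {0..?b}"
      using slot_bounds(1)[of m] by auto
    have visit: "x s = p"
      using x[of s] s0 motion_eq[OF s] u(2) by (simp add: s_def)
    have "levels (poured r) (Suc m) p = integral {?a..?b} (r p)"
      using True by (simp only: levels_Suc poured_eq[OF r p] if_True add_0_right)
    moreover have "integral {s..?b} (r p) \<le> integral {?a..?b} (r p)"
      using integral_pouring_combine[OF r p, of ?a s ?b] s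
        integral_pouring_nonneg[OF r p, of ?a s] slot_bounds(1)[of m] by (simp del: of_nat_Suc)
    ultimately have "integral {s..?b} (r p) \<le> levels (poured r) (Suc m) p"
      by linarith
    then show ?thesis
      using s0 visit by (intro bexI[of _ s] conjI disjI2)
  next
    case False
    then obtain s where s: "s \<in> {0..?a}" "s = 0 \<or> x s = p"
      "integral {s..?a} (r p) \<le> levels (poured r) m p"
      using Suc.IH by blast
    have "levels (poured r) (Suc m) p = integral {?a..?b} (r p) + levels (poured r) m p"
      using False by (simp only: levels_Suc poured_eq[OF r p] if_False)
    moreover have "integral {s..?b} (r p) = integral {s..?a} (r p) + integral {?a..?b} (r p)"
      using integral_pouring_combine[OF r p, of s ?a ?b] s(1)
        slot_bounds(2)[of m] by (simp del: of_nat_Suc)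
    ultimately have "integral {s..?b} (r p) \<le> levels (poured r) (Suc m) p"
      using s(3) by linarith
    moreover have "s \<in> {0..?b}"
      using s(1) slot_bounds(2)[of m] by (simp del: of_nat_Suc)
    ultimately show ?thesis
      using s(2) by (intro bexI[of _ s] conjI)
  qed
next
  case 0
  show ?case
    by (rule bexI[of _ 0]) simp_all
qed

text \<open>A single cup at level 0 holds at most \<open>2048 * T\<close> at the start of the
  current slot and gains at most \<open>T\<close> during it; \<open>2049 * 4 = 8196\<close>.\<close>

lemma water_motion_le:
  assumes r: "valid_pouring P r" and x: "\<And>t. 0 \<le> t \<Longrightarrow> x t = motion r t" and p: "p \<in> P" and t: "0 \<le> t"
  shows "water x r p t \<le> 8196 * diameter P"
proof -
  define m where "m = nat \<lfloor>t / T\<rfloor>"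
  have "real m \<le> t / T" "t / T < real m + 1"
    unfolding m_def using t T_pos by auto
  then have m: "real m * T \<le> t" "t \<le> real m * T + T"
    using T_pos by (auto simp: pos_le_divide_eq pos_divide_less_eq algebra_simps)
  obtain s where s: "s \<in> {0..real m * T}" "s = 0 \<or> x s = p"
    "integral {s..real m * T} (r p) \<le> levels (poured r) m p"
    using water_accounting[of r x p m, OF r x p] by blast
  have nonneg: "0 \<le> poured r l q" if "q \<in> P" for l q
    using poured_eq[OF r that] integral_pouring_nonneg[OF r that slot_bounds(1)] by simp
  have "(\<Sum>q\<in>{p}. levels (poured r) m q) \<le> 2048 * T * 32 ^ 0"
    by (rule sum_levels_le[OF nonneg sum_poured[OF r]]) (use p in auto)
  then have "integral {s..real m * T} (r p) \<le> 2048 * T"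
    using s(3) by simp
  moreover have "integral {real m * T..t} (r p) \<le> t - real m * T"
  proof -
    have "integral {real m * T..t} (r q) = integral {0..t} (r q) - integral {0..real m * T} (r q)"
      if "q \<in> P" for q
      using integral_pouring_combine[OF r that order_refl slot_bounds(1) m(1)] by simp
    then have "(\<Sum>q\<in>P. integral {real m * T..t} (r q)) = t - real m * T"
      using sum_integral_pouring[OF r] t slot_bounds(1)[of m] by (simp add: sum_subtractf)
    moreover have "integral {real m * T..t} (r p) \<le> (\<Sum>q\<in>P. integral {real m * T..t} (r q))"
      using integral_pouring_nonneg[OF r _ slot_bounds(1)] finite_P p by (intro member_le_sum) auto
    ultimately show ?thesis by simp
  qed
  moreover have "integral {s..real m * T} (r p) + integral {real m * T..t} (r p) = integral {s..t} (r p)"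
    using s(1) m(1) by (intro integral_pouring_combine[OF r p]) auto
  moreover have "water x r p t \<le> integral {s..t} (r p)"
    using s m(1) by (intro water_le[OF r p]) auto
  ultimately have "water x r p t \<le> 2049 * T"
    using m(2) by simp
  then show ?thesis
    by (simp add: T_def)
qed

lemma guarantees_backlog_motion: "guarantees_backlog P motion (8196 * diameter P)"
  unfolding guarantees_backlog_def
proof (intro allI impI conjI ballI)
  fix \<alpha> assume "adversary_strategy P \<alpha>"
  with T_pos unit_speed_motion motion_delayed show "\<exists>x r. play P motion \<alpha> x r"
    by (rule ex_play)
next
  fix \<alpha> x r p t assume "play P motion \<alpha> x r" "p \<in> P" "0 \<le> (t::real)"
  then show "water x r p t \<le> 8196 * diameter P"
    unfolding play_def by (intro water_motion_le) auto
qed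

end

text \<open>A diameter of \<open>0\<close> leaves at most one cup, and the player stands still at it.\<close>

lemma ex_strategy_diameter_zero:
  fixes P :: "plane set"
  assumes "finite P" "diameter P = 0"
  shows "\<exists>\<sigma>. player_strategy P \<sigma> \<and> guarantees_backlog P \<sigma> 0"
proof -
  obtain h where h: "P \<subseteq> {h}"
  proof (cases "P = {}")
    case False
    then obtain h where "h \<in> P" by blast
    moreover have "p = h" if "p \<in> P" for p
      using diameter_bounded_bound[OF finite_imp_bounded[OF assms(1)] that \<open>h \<in> P\<close>] assms(2) by simp
    ultimately show ?thesis
      using that by blast
  qed (use that in blast)
  define x where "x = (\<lambda>t::real. h)"
  have x: "unit_speed x"
    by (simp add: x_def unit_speed_def lipschitz_on_def)
  have "player_strategy P (\<lambda>_. x)"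
    using x by (simp add: player_strategy_def)
  moreover have "guarantees_backlog P (\<lambda>_. x) 0"
    unfolding guarantees_backlog_def
  proof (intro allI impI conjI ballI)
    fix \<alpha> assume "adversary_strategy P \<alpha>"
    then have "play P (\<lambda>_. x) \<alpha> x (\<alpha> x)"
      using x unfolding play_def adversary_strategy_def by blast
    then show "\<exists>y r. play P (\<lambda>_. x) \<alpha> y r"
      by blast
  next
    fix \<alpha> y r p t assume *: "play P (\<lambda>_. x) \<alpha> y r" "p \<in> P" "0 \<le> (t::real)"
    then have "y t = p"
      using h by (auto simp: play_def x_def)
    \<comment> \<open>The cup is being visited at time \<open>t\<close> itself, so the bounding
      integral is over one point.\<close>
    then show "water y r p t \<le> 0"
      using water_le[of P r p t t y] * by (auto simp: play_def)
  qed
  ultimately show ?thesis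
    by blast
qed

theorem theorem1:
  "\<exists>C>0. \<forall>P :: plane set. finite P \<longrightarrow>
     (\<exists>\<sigma>. player_strategy P \<sigma> \<and> guarantees_backlog P \<sigma> (C * diameter P))"
proof (intro exI[of _ 8196] conjI allI impI)
  fix P :: "plane set" assume fin: "finite P"
  show "\<exists>\<sigma>. player_strategy P \<sigma> \<and> guarantees_backlog P \<sigma> (8196 * diameter P)"
  proof (cases "diameter P = 0")
    case True
    then show ?thesis
      using ex_strategy_diameter_zero[OF fin] by simp
  next
    case False
    then obtain h where "h \<in> P"
      by (metis diameter_empty ex_in_conv)
    moreover have "0 < diameter P"
      using False diameter_ge_0[OF finite_imp_bounded[OF fin]] by simp
    ultimately interpret cup_game P h
      using fin by unfold_locales
    show ?thesis
      using player_strategy_motion guarantees_backlog_motion by blast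
  qed
qed simp

end
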